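(* Let $N\ge 1$ be an integer, let $k$ be a fixed index (a renewable power unit), and let $\widehat{\xi}_{k1},\dots,\widehat{\xi}_{kN}\in\mathbb{R}$ be $N$ equiprobable historical observations of the uncertain generation of unit $k$. Let $F_k$ be the empirical marginal cumulative distribution function $$F_k(\eta)=\frac1N\sum_{i=1}^N \mathbf{1}_{\eta\ge\widehat{\xi}_{ki}},\qquad \mathbf{1}_{\eta\ge\widehat{\xi}_{ki}}=\begin{cases}1&\text{if }\eta\ge\widehat{\xi}_{ki},\\0&\text{otherwise.}\end{cases}$$ Then for every $\eta\in\mathbb{R}$, $F_k(\eta)$ equals the optimal value of the following linear program in the decision variables $z_{k1},\dots,z_{kN}\in\mathbb{R}$ (with $\eta$ a fixed parameter): $$\begin{aligned}\max_{z_{k1},\dots,z_{kN}}\quad&\frac1N\sum_{i=1}^N z_{ki}\\ \text{s.t.}\quad& z_{ki}\,(\eta-\widehat{\xi}_{ki})\ge 0\quad\forall i\in\{1,\dots,N\},\\ & 0\le z_{ki}\le 1\quad\forall i\in\{1,\dots,N\}.\end{aligned}$$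
   Context: All definitions needed are included in the claim. "Equivalent" in the paper means that the value of the function at $\eta$ is the optimal value of the linear program. *)

theory Defs
  imports Complex_Main "HOL-Library.FuncSet"
begin

definition empirical_cdf :: "nat \<Rightarrow> ('k \<Rightarrow> nat \<Rightarrow> real) \<Rightarrow> 'k \<Rightarrow> real \<Rightarrow> real" where
  "empirical_cdf N \<xi> k \<eta> = (1 / real N) * (\<Sum>i=1..N. if \<eta> \<ge> \<xi> k i then 1 else 0)"

(* A vector of decision variables in R^N is a real-valued function on {1..N},
   represented extensionally outside that set. *)
definition lp_feasible :: "nat \<Rightarrow> ('k \<Rightarrow> nat \<Rightarrow> real) \<Rightarrow> 'k \<Rightarrow> real \<Rightarrow> (nat \<Rightarrow> real) set" where
  "lp_feasible N \<xi> k \<eta> =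
     {z \<in> {1..N} \<rightarrow>\<^sub>E UNIV.
        (\<forall>i\<in>{1..N}. z i * (\<eta> - \<xi> k i) \<ge> 0) \<and> (\<forall>i\<in>{1..N}. 0 \<le> z i \<and> z i \<le> 1)}"

definition lp_objective :: "nat \<Rightarrow> (nat \<Rightarrow> real) \<Rightarrow> real" where
  "lp_objective N z = (1 / real N) * (\<Sum>i=1..N. z i)"

(* The value must be attained at a maximizer, so an infeasible or unbounded problem,
   or one with an unattained supremum, has no optimal value. *)
definition is_optimal_value :: "('a \<Rightarrow> real) \<Rightarrow> 'a set \<Rightarrow> real \<Rightarrow> bool" where
  "is_optimal_value f S v \<longleftrightarrow> (\<exists>z. is_arg_max f (\<lambda>z. z \<in> S) z \<and> f z = v)"

end

theory Submission imports Defs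
begin

text \<open>The program decouples: each \<open>z i\<close> has its own constraints, and the
  objective weights all coordinates by the same nonnegative 1/N. The largest admissible
  \<open>z i\<close> is the indicator of \<open>\<xi> k i \<le> \<eta>\<close>.
  \<open>lp_feasible_le_indicator\<close> is this coordinatewise bound; averaging it bounds the
  objective by the empirical CDF, and the vector of indicators attains the bound.\<close>

lemma lp_feasible_le_indicator:
  assumes "z \<in> lp_feasible N \<xi> k \<eta>" and "i \<in> {1..N}"
  shows "z i \<le> (if \<eta> \<ge> \<xi> k i then 1 else 0)"
proof -
  have "0 \<le> z i * (\<eta> - \<xi> k i)" and "0 \<le> z i" and "z i \<le> 1"
    using assms by (auto simp: lp_feasible_def)
  \<comment> \<open>If \<open>\<eta> < \<xi> k i\<close>, the second factor is negative, so the sign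
    constraint together with \<open>0 \<le> z i\<close> forces \<open>z i = 0\<close>. Otherwise
    \<open>z i \<le> 1\<close> is already the claim.\<close>
  then show ?thesis
    by (auto simp: zero_le_mult_iff)
qed

lemma lp_objective_le_empirical_cdf:
  assumes "z \<in> lp_feasible N \<xi> k \<eta>"
  shows "lp_objective N z \<le> empirical_cdf N \<xi> k \<eta>"
  unfolding lp_objective_def empirical_cdf_def
  using lp_feasible_le_indicator[OF assms]
  by (intro mult_left_mono sum_mono) auto

theorem lemma1:
  fixes N :: nat and k :: 'k and \<xi> :: "'k \<Rightarrow> nat \<Rightarrow> real" and \<eta> :: real
  assumes "N \<ge> 1"
  shows "is_optimal_value (lp_objective N) (lp_feasible N \<xi> k \<eta>) (empirical_cdf N \<xi> k \<eta>)"
proof -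
  \<comment> \<open>The maximizer is restricted to \<open>{1..N}\<close> because feasible vectors
    are extensional. At a tie \<open>\<eta> = \<xi> k i\<close> the sign constraint reads 0 \<ge> 0,
    so the value 1 is allowed there, matching the non-strict inequality in the CDF.\<close>
  define z where "z = (\<lambda>i\<in>{1..N}. if \<eta> \<ge> \<xi> k i then 1 else (0::real))"
  have feasible: "z \<in> lp_feasible N \<xi> k \<eta>"
    by (auto simp: z_def lp_feasible_def)
  have value_z: "lp_objective N z = empirical_cdf N \<xi> k \<eta>"
    by (simp add: z_def lp_objective_def empirical_cdf_def)
  have "is_arg_max (lp_objective N) (\<lambda>z. z \<in> lp_feasible N \<xi> k \<eta>) z"
    using feasible
    by (simp add: is_arg_max_linorder value_z lp_objective_le_empirical_cdf)
  with value_z show ?thesis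
    by (auto simp: is_optimal_value_def)
qed

end
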